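(* There is an absolute constant $C \geq 1$ such that for each $1 \leq p \leq \infty$ and all positive integers $m,n$, $$\chi_{\mathrm{mon}}(\mathcal{P}(^m \ell_p^n)) \leq C^m \Big(1+\frac{n}{m} \Big)^{(m-1)\left( 1-\frac{1}{\min \{p,2\} }\right)}.$$
   Context: $\ell_p^n$ is $\mathbb{C}^n$ with the $p$-norm $\|z\|_p=(\sum_k|z_k|^p)^{1/p}$ (maximum norm for $p=\infty$). For a Banach space $X=(\mathbb{C}^n,\|\cdot\|)$ with open unit ball $B_X$, $\mathcal{P}(^mX)$ is the Banach space of all $m$-homogeneous polynomials $P(z)=\sum_{|\alpha|=m}a_\alpha z^\alpha$ on $\mathbb{C}^n$ (sum over $\alpha\in\mathbb{N}_0^n$ with $|\alpha|=\alpha_1+\dots+\alpha_n=m$) with norm $\sup_{z\in B_X}|P(z)|$. The unconditional basis constant of the monomials $\chi_{\mathrm{mon}}(\mathcal{P}(^mX))$ is the best constant $K\ge 1$ such that for every $m$-homogeneous polynomial $\sum_{|\alpha|=m}a_\alpha z^\alpha$ on $\mathbb{C}^n$ and all scalars $\varepsilon_\alpha\in\mathbb{C}$ with $|\varepsilon_\alpha|\le 1$, $$\sup_{z\in B_X}\Big|\sum_{|\alpha|=m}\varepsilon_\alpha a_\alpha z^\alpha\Big|\le K\sup_{z\in B_X}\Big|\sum_{|\alpha|=m}a_\alpha z^\alpha\Big| .$$ *)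

theory Defs
  imports Complex_Main "HOL-Library.Extended_Real"
begin

text \<open>
  The dimension \<open>n\<close> varies under the scope of an absolute constant, so \<open>\<complex>\<^sup>n\<close> is not a
  type: its elements are the sequences vanishing at all indices \<open>k \<ge> n\<close>, with coordinates
  indexed by \<open>0, \<dots>, n - 1\<close>. Multi-indices are encoded in the same way.
\<close>

definition cvec :: "nat \<Rightarrow> (nat \<Rightarrow> complex) set" where
  "cvec n = {z. \<forall>k\<ge>n. z k = 0}"

definition multi_indices :: "nat \<Rightarrow> nat \<Rightarrow> (nat \<Rightarrow> nat) set" where
  "multi_indices n m = {\<alpha>. (\<forall>k\<ge>n. \<alpha> k = 0) \<and> (\<Sum>k<n. \<alpha> k) = m}"

definition monomial :: "nat \<Rightarrow> (nat \<Rightarrow> nat) \<Rightarrow> (nat \<Rightarrow> complex) \<Rightarrow> complex" where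
  "monomial n \<alpha> z = (\<Prod>k<n. z k ^ \<alpha> k)"

definition hom_poly ::
    "nat \<Rightarrow> nat \<Rightarrow> ((nat \<Rightarrow> nat) \<Rightarrow> complex) \<Rightarrow> (nat \<Rightarrow> complex) \<Rightarrow> complex" where
  "hom_poly n m a z = (\<Sum>\<alpha>\<in>multi_indices n m. a \<alpha> * monomial n \<alpha> z)"

definition unit_ball :: "nat \<Rightarrow> ((nat \<Rightarrow> complex) \<Rightarrow> real) \<Rightarrow> (nat \<Rightarrow> complex) set" where
  "unit_ball n N = {z \<in> cvec n. N z < 1}"

text \<open>
  The supremum is taken in the reals; it is a genuine supremum whenever \<open>N\<close> is a norm
  (see \<open>bdd_above_hom_poly\<close> below for the norms of \<open>\<ell>\<^sub>p\<^sup>n\<close>).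
\<close>

definition poly_norm ::
    "nat \<Rightarrow> nat \<Rightarrow> ((nat \<Rightarrow> complex) \<Rightarrow> real) \<Rightarrow> ((nat \<Rightarrow> nat) \<Rightarrow> complex) \<Rightarrow> real" where
  "poly_norm n m N a = (SUP z\<in>unit_ball n N. cmod (hom_poly n m a z))"

text \<open>
  The best constant for the space \<open>(\<complex>\<^sup>n, N)\<close>. The infimum is taken in the extended reals, so
  that it would be \<open>\<infinity>\<close> (and not an unspecified real) if no constant \<open>K\<close> were admissible.
\<close>

definition chi_mon :: "nat \<Rightarrow> nat \<Rightarrow> ((nat \<Rightarrow> complex) \<Rightarrow> real) \<Rightarrow> ereal" where
  "chi_mon n m N = Inf {ereal K | K. K \<ge> 1 \<and>
     (\<forall>a \<epsilon>. (\<forall>\<alpha>\<in>multi_indices n m. cmod (\<epsilon> \<alpha>) \<le> 1) \<longrightarrow>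
        poly_norm n m N (\<lambda>\<alpha>. \<epsilon> \<alpha> * a \<alpha>) \<le> K * poly_norm n m N a)}"

definition lp_norm :: "ereal \<Rightarrow> nat \<Rightarrow> (nat \<Rightarrow> complex) \<Rightarrow> real" where
  "lp_norm p n z =
     (if p = \<infinity> then Max ((\<lambda>k. cmod (z k)) ` {..<n})
      else (\<Sum>k<n. cmod (z k) powr real_of_ereal p) powr (1 / real_of_ereal p))"

lemma norm_coord_le_lp_norm:
  assumes "1 \<le> p" "k < n"
  shows "cmod (z k) \<le> lp_norm p n z"
proof (cases "p = \<infinity>")
  case True
  then show ?thesis using assms by (auto simp: lp_norm_def)
next
  case False
  define q where "q = real_of_ereal p"
  have q: "q \<ge> 1" using assms(1) False unfolding q_def by (cases p) auto
  have "cmod (z k) powr q \<le> (\<Sum>k<n. cmod (z k) powr q)"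
    by (rule member_le_sum) (use assms in auto)
  then have "(cmod (z k) powr q) powr (1 / q) \<le> (\<Sum>k<n. cmod (z k) powr q) powr (1 / q)"
    by (intro powr_mono2) (use q in auto)
  then show ?thesis
    using q False by (simp add: lp_norm_def q_def[symmetric] powr_powr)
qed

lemma zero_in_unit_ball_lp:
  assumes "1 \<le> p" "1 \<le> n"
  shows "(\<lambda>_. 0) \<in> unit_ball n (lp_norm p n)"
proof -
  have "(\<lambda>k. cmod 0) ` {..<n} = {0}" using assms by (auto simp: image_constant_conv lessThan_empty_iff)
  then show ?thesis by (auto simp: unit_ball_def cvec_def lp_norm_def)
qed

lemma bdd_above_hom_poly:
  assumes "1 \<le> p"
  shows "bdd_above ((\<lambda>z. cmod (hom_poly n m a z)) ` unit_ball n (lp_norm p n))"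
proof (rule bdd_aboveI2)
  fix z assume z: "z \<in> unit_ball n (lp_norm p n)"
  have "cmod (z k) \<le> 1" if "k < n" for k
    using norm_coord_le_lp_norm[OF assms that, of z] z by (simp add: unit_ball_def)
  then have mon: "cmod (monomial n \<alpha> z) \<le> 1" for \<alpha>
    by (auto simp: monomial_def norm_mult norm_power simp flip: prod_norm
        intro!: prod_le_1 power_le_one)
  have "cmod (a \<alpha> * monomial n \<alpha> z) \<le> cmod (a \<alpha>)" for \<alpha>
    using mult_left_mono[OF mon, of "cmod (a \<alpha>)" \<alpha>] by (simp add: norm_mult)
  then show "cmod (hom_poly n m a z) \<le> (\<Sum>\<alpha>\<in>multi_indices n m. cmod (a \<alpha>))"
    unfolding hom_poly_def by (intro sum_norm_le)
qed

lemma finite_multi_indices: "finite (multi_indices n m)"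
proof (rule finite_subset)
  show "multi_indices n m \<subseteq> {\<alpha>. \<forall>k. (k \<in> {..<n} \<longrightarrow> \<alpha> k \<in> {..m}) \<and> (k \<notin> {..<n} \<longrightarrow> \<alpha> k = 0)}"
  proof
    fix \<alpha> assume \<alpha>: "\<alpha> \<in> multi_indices n m"
    have "\<alpha> k \<le> m" if "k < n" for k
      using member_le_sum[of k "{..<n}" \<alpha>] that \<alpha> by (simp add: multi_indices_def)
    then show "\<alpha> \<in> {\<alpha>. \<forall>k. (k \<in> {..<n} \<longrightarrow> \<alpha> k \<in> {..m}) \<and> (k \<notin> {..<n} \<longrightarrow> \<alpha> k = 0)}"
      using \<alpha> by (simp add: multi_indices_def)
  qed
qed (rule finite_set_of_finite_funs; simp)

end

theory Submission
  imports Defs "HOL-Complex_Analysis.Cauchy_Integral_Formula"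
begin

text \<open>
  For \<open>1 \<le> p < \<infinity>\<close>, differentiate \<open>P\<close> at \<open>z\<close> in direction \<open>w\<close> and extract the coefficient of
  \<open>z\<^sup>\<beta>\<close>, \<open>|\<beta>| = m - 1\<close>, by Cauchy's estimate at the radii \<open>(\<beta>\<^sub>k / (m - 1))\<^sup>1\<^sup>/\<^sup>p\<close>. Choosing the
  phases of \<open>w\<close> bounds the sum of \<open>|u\<^sub>k c(\<beta> + e\<^sub>k)|\<close> over \<open>k\<close> by
  \<open>C\<^sup>m ((m - 1)! / \<beta>!)\<^sup>1\<^sup>/\<^sup>p \<parallel>P\<parallel>\<close>. Summing against \<open>|u\<^sup>\<beta>|\<close>, Hoelder's inequality and the multinomial
  theorem leave only the number of multi-indices of order \<open>m - 1\<close> to the power \<open>1 - 1/p\<close>.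

  For \<open>p \<ge> 2\<close>, replacing \<open>P\<close> by \<open>z \<mapsto> P(u z)\<close> reduces the claim to the polydisc. There
  Cauchy-Schwarz bounds the coefficient sum by the square root of the same number times the sum
  of the \<open>L\<^sup>2\<close> norms of the partial derivatives. On homogeneous polynomials of degree \<open>d\<close> the \<open>L\<^sup>2\<close>
  norm is at most \<open>2\<^sup>d\<close> times the \<open>L\<^sup>1\<close> norm (interpolate between \<open>L\<^sup>1\<close> and \<open>L\<^sup>4\<close>, computing the
  \<open>L\<^sup>4\<close> norm from the coefficients of the square), and the sum of the \<open>L\<^sup>1\<close> norms is the average of
  directional derivatives with optimal phases.
\<close>

section \<open>Monomials and sampling at roots of unity\<close>

lemma multi_indices_eqI:
  assumes "\<alpha> \<in> multi_indices n m" "\<beta> \<in> multi_indices n l" "\<And>k. k < n \<Longrightarrow> \<alpha> k = \<beta> k"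
  shows "\<alpha> = \<beta>"
proof
  fix k show "\<alpha> k = \<beta> k"
    using assms by (cases "k < n") (auto simp: multi_indices_def)
qed

lemma multi_indices_le:
  assumes "\<alpha> \<in> multi_indices n m" shows "\<alpha> k \<le> m"
proof (cases "k < n")
  case True
  then show ?thesis
    using member_le_sum[of k "{..<n}" \<alpha>] assms by (simp add: multi_indices_def)
qed (use assms in \<open>auto simp: multi_indices_def\<close>)

lemma monomial_mult: "monomial n \<alpha> (\<lambda>k. u k * z k) = monomial n \<alpha> u * monomial n \<alpha> z"
  by (simp add: monomial_def power_mult_distrib prod.distrib)

lemma monomial_add: "monomial n (\<lambda>k. \<alpha> k + \<beta> k) z = monomial n \<alpha> z * monomial n \<beta> z"
  by (simp add: monomial_def power_add prod.distrib)

lemma cmod_monomial: "cmod (monomial n \<alpha> z) = (\<Prod>k<n. cmod (z k) ^ \<alpha> k)"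
  by (simp add: monomial_def norm_power flip: prod_norm)

lemma monomial_const_mult:
  assumes "\<alpha> \<in> multi_indices n m"
  shows "monomial n \<alpha> (\<lambda>k. c * z k) = c ^ m * monomial n \<alpha> z"
  using assms unfolding monomial_mult
  by (simp add: monomial_def multi_indices_def flip: power_sum)

lemma hom_poly_mult:
  "hom_poly n m a (\<lambda>k. u k * z k) = hom_poly n m (\<lambda>\<alpha>. a \<alpha> * monomial n \<alpha> u) z"
  by (simp add: hom_poly_def monomial_mult mult_ac)

lemma hom_poly_const_mult: "hom_poly n m a (\<lambda>k. c * z k) = c ^ m * hom_poly n m a z"
  unfolding hom_poly_def sum_distrib_left
  by (intro sum.cong) (auto simp: monomial_const_mult mult_ac)

text \<open>
  Averages over these points replace integrals over the torus; they are exact on products of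
  a monomial and a conjugated one as long as all exponents are below \<open>N\<close>.
\<close>

definition grid :: "nat \<Rightarrow> nat \<Rightarrow> (nat \<Rightarrow> nat) set" where
  "grid n N = PiE {..<n} (\<lambda>_. {..<N})"

definition grid_point :: "nat \<Rightarrow> nat \<Rightarrow> (nat \<Rightarrow> nat) \<Rightarrow> nat \<Rightarrow> complex" where
  "grid_point n N t k = (if k < n then cis (2 * pi * real (t k) / real N) else 0)"

lemma card_grid: "card (grid n N) = N ^ n"
  by (simp add: grid_def card_PiE)

lemma grid_point_in_cvec: "grid_point n N t \<in> cvec n"
  by (simp add: grid_point_def cvec_def)

lemma cmod_grid_point: "k < n \<Longrightarrow> cmod (grid_point n N t k) = 1"
  by (simp add: grid_point_def)

lemma sum_roots_of_unity_orthogonal: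
  assumes "a < N" "b < N"
  shows "(\<Sum>j<N. cis (2 * pi * real j / real N) ^ a * cnj (cis (2 * pi * real j / real N) ^ b)) =
    (if a = b then of_nat N else 0)"
proof -
  define \<theta> where "\<theta> = 2 * pi * (real a - real b) / real N"
  have eq: "cis (2 * pi * real j / real N) ^ a * cnj (cis (2 * pi * real j / real N) ^ b) =
      cis \<theta> ^ j" for j
  proof -
    have "cis (2 * pi * real j / real N) ^ a * cnj (cis (2 * pi * real j / real N) ^ b) =
       cis (real a * (2 * pi * real j / real N) + - (real b * (2 * pi * real j / real N)))"
      by (simp add: Complex.DeMoivre cis_cnj cis_mult)
    also have "real a * (2 * pi * real j / real N) + - (real b * (2 * pi * real j / real N)) =
        real j * \<theta>"
      by (simp add: \<theta>_def algebra_simps diff_divide_distrib)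
    finally show ?thesis by (simp add: Complex.DeMoivre)
  qed
  show ?thesis
  proof (cases "a = b")
    case True
    then show ?thesis unfolding eq by (simp add: \<theta>_def)
  next
    case False
    have ne: "cis \<theta> \<noteq> 1"
    proof
      assume "cis \<theta> = 1"
      then have "cos \<theta> = 1" by (simp add: complex_eq_iff)
      then obtain i :: int where i: "\<theta> = real_of_int i * 2 * pi"
        using cos_one_2pi_int by blast
      have "real a - real b = real_of_int i * real N"
      proof -
        have "2 * pi * (real a - real b) = 2 * pi * (real_of_int i * real N)"
          using i assms by (simp add: \<theta>_def divide_eq_eq mult_ac)
        then show ?thesis by simp
      qed
      then have ii: "int a - int b = i * int N"
        by (metis of_int_diff of_int_eq_iff of_int_mult of_int_of_nat_eq)
      have lt: "\<bar>int a - int b\<bar> < int N" using assms by auto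
      have "i \<noteq> 0" using ii False by auto
      then have "1 * int N \<le> \<bar>i\<bar> * int N" by (intro mult_right_mono) auto
      then show False using ii lt by (simp add: abs_mult)
    qed
    have "cis \<theta> ^ N = 1"
    proof -
      have "cis \<theta> ^ N = cis (2 * pi * (real_of_int (int a - int b)))"
        using assms by (simp add: Complex.DeMoivre \<theta>_def)
      then show ?thesis by (simp only: cis_multiple_2pi[OF Ints_of_int])
    qed
    then show ?thesis unfolding eq using ne False by (simp add: geometric_sum)
  qed
qed

lemma monomial_orthogonal:
  assumes "\<alpha> \<in> multi_indices n m" "\<beta> \<in> multi_indices n m" "m < N"
  shows "(\<Sum>t\<in>grid n N. monomial n \<alpha> (grid_point n N t) * cnj (monomial n \<beta> (grid_point n N t))) =
    (if \<alpha> = \<beta> then of_nat (N ^ n) else 0)"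
proof -
  have "(\<Sum>t\<in>grid n N. monomial n \<alpha> (grid_point n N t) * cnj (monomial n \<beta> (grid_point n N t))) =
     (\<Sum>t\<in>grid n N. \<Prod>k<n. cis (2 * pi * real (t k) / real N) ^ \<alpha> k *
        cnj (cis (2 * pi * real (t k) / real N) ^ \<beta> k))"
    by (simp add: monomial_def grid_point_def prod.distrib)
  also have "\<dots> = (\<Prod>k<n. \<Sum>j<N. cis (2 * pi * real j / real N) ^ \<alpha> k *
        cnj (cis (2 * pi * real j / real N) ^ \<beta> k))"
    unfolding grid_def by (rule prod_sum_PiE[symmetric]) auto
  also have "\<dots> = (\<Prod>k<n. if \<alpha> k = \<beta> k then of_nat N else 0)"
    by (intro prod.cong refl sum_roots_of_unity_orthogonal)
      (use assms multi_indices_le le_less_trans in blast)+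
  also have "\<dots> = (if \<alpha> = \<beta> then of_nat (N ^ n) else 0)"
  proof (cases "\<alpha> = \<beta>")
    case False
    then obtain k where "k < n" "\<alpha> k \<noteq> \<beta> k" using multi_indices_eqI assms by metis
    then have "(\<Prod>k<n. if \<alpha> k = \<beta> k then of_nat N else 0) = (0 :: complex)"
      by (intro prod_zero) auto
    then show ?thesis using False by simp
  qed simp
  finally show ?thesis .
qed

lemma sum_grid_hom_poly_coeff:
  assumes "\<beta> \<in> multi_indices n m" "m < N"
  shows "(\<Sum>t\<in>grid n N. hom_poly n m a (grid_point n N t) * cnj (monomial n \<beta> (grid_point n N t))) =
    of_nat (N ^ n) * a \<beta>"
proof -
  have "(\<Sum>t\<in>grid n N. hom_poly n m a (grid_point n N t) * cnj (monomial n \<beta> (grid_point n N t))) =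
    (\<Sum>\<alpha>\<in>multi_indices n m. a \<alpha> *
      (\<Sum>t\<in>grid n N. monomial n \<alpha> (grid_point n N t) * cnj (monomial n \<beta> (grid_point n N t))))"
    unfolding hom_poly_def sum_distrib_right sum_distrib_left
    by (subst sum.swap) (simp add: mult_ac)
  also have "\<dots> = (\<Sum>\<alpha>\<in>multi_indices n m. if \<alpha> = \<beta> then of_nat (N ^ n) * a \<alpha> else 0)"
    by (intro sum.cong refl) (use assms in \<open>simp add: monomial_orthogonal\<close>)
  also have "\<dots> = of_nat (N ^ n) * a \<beta>"
    using assms by (simp add: finite_multi_indices)
  finally show ?thesis .
qed

lemma parseval_grid:
  assumes "m < N"
  shows "(\<Sum>t\<in>grid n N. (cmod (hom_poly n m a (grid_point n N t)))\<^sup>2) =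
    real (N ^ n) * (\<Sum>\<alpha>\<in>multi_indices n m. (cmod (a \<alpha>))\<^sup>2)"
proof -
  let ?f = "\<lambda>t. hom_poly n m a (grid_point n N t)"
  have "complex_of_real (\<Sum>t\<in>grid n N. (cmod (?f t))\<^sup>2) = (\<Sum>t\<in>grid n N. ?f t * cnj (?f t))"
    by (simp only: of_real_sum complex_norm_square)
  also have "\<dots> = (\<Sum>t\<in>grid n N. \<Sum>\<beta>\<in>multi_indices n m.
      cnj (a \<beta>) * (?f t * cnj (monomial n \<beta> (grid_point n N t))))"
    by (intro sum.cong refl, subst (2) hom_poly_def) (simp add: sum_distrib_left mult_ac)
  also have "\<dots> = (\<Sum>\<beta>\<in>multi_indices n m. cnj (a \<beta>) *
      (\<Sum>t\<in>grid n N. ?f t * cnj (monomial n \<beta> (grid_point n N t))))"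
    unfolding sum_distrib_left by (rule sum.swap)
  also have "\<dots> = (\<Sum>\<beta>\<in>multi_indices n m. of_nat (N ^ n) * (a \<beta> * cnj (a \<beta>)))"
    by (intro sum.cong refl) (use assms in \<open>simp add: sum_grid_hom_poly_coeff\<close>)
  also have "\<dots> = of_real (real (N ^ n) * (\<Sum>\<alpha>\<in>multi_indices n m. (cmod (a \<alpha>))\<^sup>2))"
    by (simp only: of_real_mult of_real_sum complex_norm_square sum_distrib_left of_real_of_nat_eq)
  finally show ?thesis by (simp only: of_real_eq_iff)
qed

lemma coeff_bound:
  assumes "\<And>z. z \<in> cvec n \<Longrightarrow> (\<And>k. k < n \<Longrightarrow> cmod (z k) = r k) \<Longrightarrow> cmod (hom_poly n m a z) \<le> B"
    and r: "\<And>k. k < n \<Longrightarrow> r k \<ge> 0"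
    and \<beta>: "\<beta> \<in> multi_indices n m"
  shows "cmod (a \<beta>) * (\<Prod>k<n. r k ^ \<beta> k) \<le> B"
proof -
  define N where "N = Suc m"
  define b where "b = (\<lambda>\<alpha>. a \<alpha> * monomial n \<alpha> (\<lambda>k. complex_of_real (r k)))"
  let ?f = "\<lambda>t. hom_poly n m b (grid_point n N t)"
  have f: "cmod (?f t) \<le> B" for t
    unfolding b_def hom_poly_mult[symmetric]
    by (rule assms(1)) (use r in \<open>auto simp: norm_mult cvec_def grid_point_def\<close>)
  have "real (N ^ n) * cmod (b \<beta>) = cmod (of_nat (N ^ n) * b \<beta>)"
    by (simp only: norm_mult norm_of_nat)
  also have "\<dots> = cmod (\<Sum>t\<in>grid n N. ?f t * cnj (monomial n \<beta> (grid_point n N t)))"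
    by (subst sum_grid_hom_poly_coeff[OF \<beta>]) (simp_all add: N_def)
  also have "\<dots> \<le> (\<Sum>t\<in>grid n N. B)"
    by (intro sum_norm_le) (simp add: norm_mult cmod_monomial cmod_grid_point f)
  also have "\<dots> = real (N ^ n) * B" by (simp add: card_grid)
  finally have "cmod (b \<beta>) \<le> B" by (simp add: N_def)
  moreover have "(\<Prod>k<n. \<bar>r k\<bar> ^ \<beta> k) = (\<Prod>k<n. r k ^ \<beta> k)"
    using r by (intro prod.cong) auto
  ultimately show ?thesis by (simp add: b_def norm_mult cmod_monomial)
qed

section \<open>Counting multi-indices and comparing norms on the grid\<close>

lemma inj_on_restrict_multi_indices:
  "inj_on (\<lambda>\<alpha>. restrict \<alpha> {..<n}) (multi_indices n m)"
  by (rule inj_onI, rule multi_indices_eqI) (auto simp: restrict_def fun_eq_iff, metis)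

lemma card_multi_indices_mult_power_le:
  fixes t :: real
  assumes "0 \<le> t" "t < 1"
  shows "real (card (multi_indices n m)) * t ^ m \<le> (1 / (1 - t)) ^ n"
proof -
  have "real (card (multi_indices n m)) * t ^ m = (\<Sum>\<alpha>\<in>multi_indices n m. \<Prod>k<n. t ^ \<alpha> k)"
    by (simp add: multi_indices_def flip: power_sum)
  also have "\<dots> = (\<Sum>g\<in>(\<lambda>\<alpha>. restrict \<alpha> {..<n}) ` multi_indices n m. \<Prod>k<n. t ^ g k)"
    by (simp add: sum.reindex inj_on_restrict_multi_indices)
  also have "\<dots> \<le> (\<Sum>g\<in>PiE {..<n} (\<lambda>_. {..<Suc m}). \<Prod>k<n. t ^ g k)"
    by (rule sum_mono2)
      (use assms in \<open>auto simp: finite_PiE multi_indices_le less_Suc_eq_le intro!: prod_nonneg split: if_splits\<close>)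
  also have "\<dots> = (\<Prod>k<n. \<Sum>j<Suc m. t ^ j)"
    by (rule prod_sum_PiE[symmetric]) auto
  also have "(\<Sum>j<Suc m. t ^ j) \<le> 1 / (1 - t)"
    using assms by (subst sum_gp_strict) (auto simp: divide_right_mono)
  then have "(\<Prod>k<n. \<Sum>j<Suc m. t ^ j) \<le> (1 / (1 - t)) ^ n"
    using assms by (simp del: sum.lessThan_Suc add: power_mono sum_nonneg)
  finally show ?thesis .
qed

lemma card_multi_indices_le:
  assumes "1 \<le> m" "1 \<le> n"
  shows "real (card (multi_indices n (m - 1))) \<le> exp (real m) * (1 + real n / real m) ^ (m - 1)"
proof -
  define t where "t = real m / (real m + real n)"
  have t: "0 < t" "t < 1" using assms by (auto simp: t_def)
  have inv: "1 / t = 1 + real n / real m" "1 / (1 - t) = 1 + real m / real n"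
    using assms by (auto simp: t_def field_simps)
  have "real (card (multi_indices n (m - 1))) \<le> (1 / (1 - t)) ^ n / t ^ (m - 1)"
    using card_multi_indices_mult_power_le[of t n "m - 1"] t by (simp add: pos_le_divide_eq)
  also have "\<dots> = (1 + real m / real n) ^ n * (1 + real n / real m) ^ (m - 1)"
    unfolding inv[symmetric] by (simp add: power_divide)
  also have "\<dots> \<le> exp (real m) * (1 + real n / real m) ^ (m - 1)"
    using exp_ge_one_plus_x_over_n_power_n[of n "real m"] assms
    by (intro mult_right_mono) auto
  finally show ?thesis .
qed

lemma card_multi_indices_below_le:
  "card {\<alpha> \<in> multi_indices n m. \<forall>k<n. \<alpha> k \<le> \<gamma> k} \<le> 2 ^ (\<Sum>k<n. \<gamma> k)"
proof -
  have "card {\<alpha> \<in> multi_indices n m. \<forall>k<n. \<alpha> k \<le> \<gamma> k} \<le> card (PiE {..<n} (\<lambda>k. {..\<gamma> k}))"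
    by (rule card_inj_on_le[where f = "\<lambda>\<alpha>. restrict \<alpha> {..<n}"])
      (auto simp: finite_PiE split: if_splits intro: inj_on_subset[OF inj_on_restrict_multi_indices])
  also have "\<dots> = (\<Prod>k<n. Suc (\<gamma> k))" by (simp add: card_PiE)
  also have "\<dots> \<le> (\<Prod>k<n. 2 ^ \<gamma> k)"
    by (intro prod_mono) (simp add: Suc_leI less_exp)
  finally show ?thesis by (simp add: power_sum)
qed

lemma hom_poly_square:
  "(hom_poly n m d z)\<^sup>2 = hom_poly n (2 * m)
     (\<lambda>\<gamma>. \<Sum>p | p \<in> multi_indices n m \<times> multi_indices n m \<and> (\<lambda>k. fst p k + snd p k) = \<gamma>.
        d (fst p) * d (snd p)) z"
proof -
  let ?S = "multi_indices n m \<times> multi_indices n m"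
  let ?g = "\<lambda>p k. fst p k + snd p k :: nat"
  let ?h = "\<lambda>p. d (fst p) * d (snd p) * monomial n (?g p) z"
  have "(hom_poly n m d z)\<^sup>2 = sum ?h ?S"
    by (simp add: hom_poly_def power2_eq_square sum_product sum.cartesian_product monomial_add mult_ac
        case_prod_unfold)
  also have "\<dots> = (\<Sum>\<gamma>\<in>multi_indices n (2 * m). \<Sum>p | p \<in> ?S \<and> ?g p = \<gamma>. ?h p)"
    by (rule sum.group[symmetric])
      (auto simp: finite_multi_indices, auto simp: multi_indices_def sum.distrib)
  also have "\<dots> = (\<Sum>\<gamma>\<in>multi_indices n (2 * m).
      (\<Sum>p | p \<in> ?S \<and> ?g p = \<gamma>. d (fst p) * d (snd p)) * monomial n \<gamma> z)"
    unfolding sum_distrib_right by (intro sum.cong refl) auto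
  finally show ?thesis unfolding hom_poly_def .
qed

lemma sum_cmod_power4_grid_le:
  assumes "2 * m < N"
  shows "(\<Sum>t\<in>grid n N. cmod (hom_poly n m d (grid_point n N t)) ^ 4) \<le>
    real (N ^ n) * 4 ^ m * (\<Sum>\<alpha>\<in>multi_indices n m. (cmod (d \<alpha>))\<^sup>2)\<^sup>2"
proof -
  let ?S = "multi_indices n m \<times> multi_indices n m"
  let ?g = "\<lambda>p k. fst p k + snd p k :: nat"
  define F where "F \<gamma> = {p. p \<in> ?S \<and> ?g p = \<gamma>}" for \<gamma>
  define b where "b \<gamma> = (\<Sum>p\<in>F \<gamma>. d (fst p) * d (snd p))" for \<gamma>
  have sq: "(hom_poly n m d z)\<^sup>2 = hom_poly n (2 * m) b z" for z
    unfolding hom_poly_square b_def[abs_def] F_def ..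
  have finF: "finite (F \<gamma>)" for \<gamma>
    by (rule finite_subset[of _ ?S]) (auto simp: F_def finite_multi_indices)
  have cardF: "card (F \<gamma>) \<le> 4 ^ m" if "\<gamma> \<in> multi_indices n (2 * m)" for \<gamma>
  proof -
    have "card (F \<gamma>) \<le> card {\<alpha> \<in> multi_indices n m. \<forall>k<n. \<alpha> k \<le> \<gamma> k}"
    proof (rule card_inj_on_le[where f = fst])
      show "inj_on fst (F \<gamma>)"
      proof (rule inj_onI)
        fix p q assume pq: "p \<in> F \<gamma>" "q \<in> F \<gamma>" "fst p = fst q"
        have "fst p k + snd p k = fst q k + snd q k" for k
          using pq unfolding F_def by (auto simp: fun_eq_iff)
        then have "snd p k = snd q k" for k using pq(3) by (metis add_left_cancel)
        then show "p = q" using pq(3) by (auto intro!: prod_eqI)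
      qed
    qed (auto simp: F_def finite_multi_indices)
    also have "\<dots> \<le> 2 ^ (\<Sum>k<n. \<gamma> k)" by (rule card_multi_indices_below_le)
    also have "\<dots> = 4 ^ m" using that by (simp add: multi_indices_def power_mult)
    finally show ?thesis .
  qed
  have bb: "(cmod (b \<gamma>))\<^sup>2 \<le> 4 ^ m * (\<Sum>p\<in>F \<gamma>. (cmod (d (fst p)) * cmod (d (snd p)))\<^sup>2)"
    if "\<gamma> \<in> multi_indices n (2 * m)" for \<gamma>
  proof -
    have "cmod (b \<gamma>) \<le> (\<Sum>p\<in>F \<gamma>. 1 * (cmod (d (fst p)) * cmod (d (snd p))))"
      unfolding b_def by (intro sum_norm_le) (simp add: norm_mult)
    then have "(cmod (b \<gamma>))\<^sup>2 \<le> (\<Sum>p\<in>F \<gamma>. 1 * (cmod (d (fst p)) * cmod (d (snd p))))\<^sup>2"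
      by (intro power_mono) auto
    also have "\<dots> \<le> (\<Sum>p\<in>F \<gamma>. 1\<^sup>2) * (\<Sum>p\<in>F \<gamma>. (cmod (d (fst p)) * cmod (d (snd p)))\<^sup>2)"
      by (rule Cauchy_Schwarz_ineq_sum)
    also have "\<dots> \<le> 4 ^ m * (\<Sum>p\<in>F \<gamma>. (cmod (d (fst p)) * cmod (d (snd p)))\<^sup>2)"
    proof (rule mult_right_mono)
      show "(\<Sum>p\<in>F \<gamma>. 1\<^sup>2) \<le> (4 ^ m :: real)"
        using of_nat_mono[OF cardF[OF that], where 'a = real] by simp
    qed (auto intro: sum_nonneg)
    finally show ?thesis .
  qed
  have "(\<Sum>t\<in>grid n N. cmod (hom_poly n m d (grid_point n N t)) ^ 4) =
     (\<Sum>t\<in>grid n N. (cmod (hom_poly n (2 * m) b (grid_point n N t)))\<^sup>2)"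
    by (simp add: norm_power flip: sq power_mult)
  also have "\<dots> = real (N ^ n) * (\<Sum>\<gamma>\<in>multi_indices n (2 * m). (cmod (b \<gamma>))\<^sup>2)"
    using assms by (rule parseval_grid)
  also have "\<dots> \<le> real (N ^ n) * (\<Sum>\<gamma>\<in>multi_indices n (2 * m). 4 ^ m *
      (\<Sum>p\<in>F \<gamma>. (cmod (d (fst p)) * cmod (d (snd p)))\<^sup>2))"
    by (intro mult_left_mono sum_mono bb) auto
  also have "\<dots> = real (N ^ n) * 4 ^ m * (\<Sum>\<gamma>\<in>multi_indices n (2 * m).
      \<Sum>p\<in>F \<gamma>. (cmod (d (fst p)) * cmod (d (snd p)))\<^sup>2)"
    by (simp add: sum_distrib_left mult_ac)
  also have "(\<Sum>\<gamma>\<in>multi_indices n (2 * m). \<Sum>p\<in>F \<gamma>. (cmod (d (fst p)) * cmod (d (snd p)))\<^sup>2) =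
      (\<Sum>p\<in>?S. (cmod (d (fst p)) * cmod (d (snd p)))\<^sup>2)"
    unfolding F_def
    by (rule sum.group) (auto simp: finite_multi_indices, auto simp: multi_indices_def sum.distrib)
  also have "\<dots> = (\<Sum>\<alpha>\<in>multi_indices n m. (cmod (d \<alpha>))\<^sup>2)\<^sup>2"
    by (subst power2_eq_square)
      (simp add: sum_product sum.cartesian_product case_prod_unfold power_mult_distrib)
  finally show ?thesis .
qed

lemma sum_square_pow3_le:
  fixes x :: "'a \<Rightarrow> real"
  assumes "\<And>i. i \<in> I \<Longrightarrow> x i \<ge> 0"
  shows "(\<Sum>i\<in>I. (x i)\<^sup>2) ^ 3 \<le> (\<Sum>i\<in>I. x i)\<^sup>2 * (\<Sum>i\<in>I. x i ^ 4)"
proof -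
  define A where "A j = (\<Sum>i\<in>I. x i ^ j)" for j :: nat
  have A: "A j \<ge> 0" for j using assms by (auto simp: A_def intro: sum_nonneg)
  have "(\<Sum>i\<in>I. sqrt (x i) * (x i * sqrt (x i)))\<^sup>2 \<le>
      (\<Sum>i\<in>I. (sqrt (x i))\<^sup>2) * (\<Sum>i\<in>I. (x i * sqrt (x i))\<^sup>2)"
    by (rule Cauchy_Schwarz_ineq_sum)
  also have "(\<Sum>i\<in>I. sqrt (x i) * (x i * sqrt (x i))) = A 2"
    unfolding A_def by (intro sum.cong refl) (use assms in \<open>auto simp: power2_eq_square\<close>)
  also have "(\<Sum>i\<in>I. (sqrt (x i))\<^sup>2) = A 1"
    unfolding A_def by (intro sum.cong refl) (use assms in auto)
  also have "(\<Sum>i\<in>I. (x i * sqrt (x i))\<^sup>2) = A 3"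
    unfolding A_def by (intro sum.cong refl) (use assms in \<open>auto simp: power_mult_distrib eval_nat_numeral\<close>)
  finally have 1: "(A 2)\<^sup>2 \<le> A 1 * A 3" .
  have "(\<Sum>i\<in>I. x i * (x i)\<^sup>2)\<^sup>2 \<le> (\<Sum>i\<in>I. (x i)\<^sup>2) * (\<Sum>i\<in>I. ((x i)\<^sup>2)\<^sup>2)"
    by (rule Cauchy_Schwarz_ineq_sum)
  then have 2: "(A 3)\<^sup>2 \<le> A 2 * A 4"
    by (simp add: A_def eval_nat_numeral mult_ac)
  have "A 2 * A 2 ^ 3 = ((A 2)\<^sup>2)\<^sup>2" by (simp add: eval_nat_numeral)
  also have "\<dots> \<le> (A 1 * A 3)\<^sup>2" using 1 by (intro power_mono) auto
  also have "\<dots> \<le> (A 1)\<^sup>2 * (A 2 * A 4)"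
    unfolding power_mult_distrib using 2 by (intro mult_left_mono) auto
  finally have 3: "A 2 * A 2 ^ 3 \<le> A 2 * ((A 1)\<^sup>2 * A 4)" by (simp add: mult_ac)
  have "A 2 ^ 3 \<le> (A 1)\<^sup>2 * A 4"
  proof (cases "A 2 = 0")
    case False
    then have "A 2 > 0" using A[of 2] by simp
    then show ?thesis using 3 by (simp only: mult_le_cancel_left_pos)
  qed (use A in simp)
  then show ?thesis by (simp add: A_def)
qed

lemma l2_coeff_le_l1_grid:
  assumes "2 * m < N"
  shows "real (N ^ n) * sqrt (\<Sum>\<alpha>\<in>multi_indices n m. (cmod (d \<alpha>))\<^sup>2) \<le>
    2 ^ m * (\<Sum>t\<in>grid n N. cmod (hom_poly n m d (grid_point n N t)))"
proof -
  define S where "S = (\<Sum>\<alpha>\<in>multi_indices n m. (cmod (d \<alpha>))\<^sup>2)"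
  define L where "L = (\<Sum>t\<in>grid n N. cmod (hom_poly n m d (grid_point n N t)))"
  define R where "R = real (N ^ n)"
  have S: "S \<ge> 0" and L: "L \<ge> 0" by (auto simp: S_def L_def sum_nonneg)
  have R: "R > 0" using assms by (simp add: R_def)
  have "(R * S) ^ 3 \<le> L\<^sup>2 * (R * 4 ^ m * S\<^sup>2)"
  proof -
    have "(R * S) ^ 3 = (\<Sum>t\<in>grid n N. (cmod (hom_poly n m d (grid_point n N t)))\<^sup>2) ^ 3"
      using assms by (simp add: parseval_grid R_def S_def)
    also have "\<dots> \<le> L\<^sup>2 * (\<Sum>t\<in>grid n N. cmod (hom_poly n m d (grid_point n N t)) ^ 4)"
      unfolding L_def by (rule sum_square_pow3_le) auto
    also have "\<dots> \<le> L\<^sup>2 * (R * 4 ^ m * S\<^sup>2)"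
      unfolding R_def S_def using assms by (intro mult_left_mono sum_cmod_power4_grid_le) auto
    finally show ?thesis .
  qed
  then have le: "(R * S\<^sup>2) * (R\<^sup>2 * S) \<le> (R * S\<^sup>2) * (4 ^ m * L\<^sup>2)"
    by (simp add: eval_nat_numeral mult_ac)
  have "R\<^sup>2 * S \<le> 4 ^ m * L\<^sup>2"
  proof (cases "S = 0")
    case False
    then have "R * S\<^sup>2 > 0" using R by simp
    then show ?thesis using le by (simp only: mult_le_cancel_left_pos)
  qed simp
  then have "sqrt (R\<^sup>2 * S) \<le> sqrt (4 ^ m * L\<^sup>2)" by (rule real_sqrt_le_mono)
  also have "sqrt (R\<^sup>2 * S) = R * sqrt S" using R by (simp add: real_sqrt_mult)
  also have "sqrt (4 ^ m * L\<^sup>2) = 2 ^ m * L" using L by (simp add: real_sqrt_mult real_sqrt_power)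
  finally show ?thesis by (simp add: R_def S_def L_def)
qed

section \<open>Directional derivatives and the polydisc\<close>

text \<open>The coefficients of the partial derivative with respect to the \<open>k\<close>-th variable.\<close>

definition shift_coeffs ::
    "nat \<Rightarrow> ((nat \<Rightarrow> nat) \<Rightarrow> complex) \<Rightarrow> (nat \<Rightarrow> nat) \<Rightarrow> complex" where
  "shift_coeffs k c \<beta> = of_nat (Suc (\<beta> k)) * c (\<beta>(k := Suc (\<beta> k)))"

lemma multi_indices_incr_iff:
  assumes "k < n"
  shows "\<beta>(k := Suc (\<beta> k)) \<in> multi_indices n (Suc m) \<longleftrightarrow> \<beta> \<in> multi_indices n m"
proof -
  have "(\<Sum>i<n. (\<beta>(k := Suc (\<beta> k))) i) = Suc (\<Sum>i<n. \<beta> i)"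
    using assms by (subst (1 2) sum.remove[of "{..<n}" k]) auto
  moreover have "(\<forall>i\<ge>n. (\<beta>(k := Suc (\<beta> k))) i = 0) \<longleftrightarrow> (\<forall>i\<ge>n. \<beta> i = 0)"
    using assms by auto
  ultimately show ?thesis unfolding multi_indices_def mem_Collect_eq by simp
qed

lemma sum_multi_indices_incr:
  assumes "k < n"
  shows "(\<Sum>\<alpha> | \<alpha> \<in> multi_indices n (Suc m) \<and> \<alpha> k > 0. f \<alpha>) =
    (\<Sum>\<beta>\<in>multi_indices n m. f (\<beta>(k := Suc (\<beta> k))))"
proof (rule sum.reindex_bij_witness[of _ "\<lambda>\<beta>. \<beta>(k := Suc (\<beta> k))" "\<lambda>\<alpha>. \<alpha>(k := \<alpha> k - 1)"])
  fix \<alpha> assume \<alpha>: "\<alpha> \<in> {\<alpha>. \<alpha> \<in> multi_indices n (Suc m) \<and> \<alpha> k > 0}"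
  then show eq: "(\<alpha>(k := \<alpha> k - 1))(k := Suc ((\<alpha>(k := \<alpha> k - 1)) k)) = \<alpha>"
    by simp
  show "\<alpha>(k := \<alpha> k - 1) \<in> multi_indices n m"
    using \<alpha> by (subst multi_indices_incr_iff[OF assms, symmetric], subst eq) simp
  show "f ((\<alpha>(k := \<alpha> k - 1))(k := Suc ((\<alpha>(k := \<alpha> k - 1)) k))) = f \<alpha>"
    unfolding eq ..
next
  fix \<beta> assume "\<beta> \<in> multi_indices n m"
  then show "\<beta>(k := Suc (\<beta> k)) \<in> {\<alpha>. \<alpha> \<in> multi_indices n (Suc m) \<and> \<alpha> k > 0}"
    unfolding mem_Collect_eq multi_indices_incr_iff[OF assms] by simp
qed simp

lemma sum_multi_indices_Suc_le:
  fixes f :: "(nat \<Rightarrow> nat) \<Rightarrow> real"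
  assumes "\<And>\<alpha>. f \<alpha> \<ge> 0"
  shows "(\<Sum>\<alpha>\<in>multi_indices n (Suc m). f \<alpha>) \<le>
    (\<Sum>k<n. \<Sum>\<beta>\<in>multi_indices n m. f (\<beta>(k := Suc (\<beta> k))))"
proof -
  have "f \<alpha> \<le> (\<Sum>k<n. if \<alpha> k > 0 then f \<alpha> else 0)" if "\<alpha> \<in> multi_indices n (Suc m)" for \<alpha>
  proof -
    have "(\<Sum>k<n. \<alpha> k) \<noteq> 0" using that by (simp add: multi_indices_def)
    then obtain k where k: "k < n" "\<alpha> k > 0" by (meson lessThan_iff neq0_conv sum.neutral)
    then have "(if \<alpha> k > 0 then f \<alpha> else 0) \<le> (\<Sum>k<n. if \<alpha> k > 0 then f \<alpha> else 0)"
      using assms by (intro member_le_sum) auto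
    then show ?thesis using k by simp
  qed
  then have "(\<Sum>\<alpha>\<in>multi_indices n (Suc m). f \<alpha>) \<le>
      (\<Sum>\<alpha>\<in>multi_indices n (Suc m). \<Sum>k<n. if \<alpha> k > 0 then f \<alpha> else 0)"
    by (rule sum_mono)
  also have "\<dots> = (\<Sum>k<n. \<Sum>\<alpha>\<in>multi_indices n (Suc m). if \<alpha> k > 0 then f \<alpha> else 0)"
    by (rule sum.swap)
  also have "\<dots> = (\<Sum>k<n. \<Sum>\<beta>\<in>multi_indices n m. f (\<beta>(k := Suc (\<beta> k))))"
  proof (rule sum.cong[OF refl])
    fix k assume "k \<in> {..<n}"
    then have "k < n" by simp
    show "(\<Sum>\<alpha>\<in>multi_indices n (Suc m). if \<alpha> k > 0 then f \<alpha> else 0) =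
        (\<Sum>\<beta>\<in>multi_indices n m. f (\<beta>(k := Suc (\<beta> k))))"
      unfolding sum_multi_indices_incr[OF \<open>k < n\<close>, symmetric]
      by (rule sum.inter_filter[OF finite_multi_indices, symmetric])
  qed
  finally show ?thesis .
qed

lemma hom_poly_line_has_derivative:
  "((\<lambda>x. hom_poly n (Suc m) c (\<lambda>k. z k + x * w k)) has_field_derivative
     (\<Sum>k<n. w k * hom_poly n m (shift_coeffs k c) z)) (at 0)"
proof -
  let ?r = "\<lambda>\<alpha> k. \<Prod>j\<in>{..<n} - {k}. z j ^ \<alpha> j"
  have mono: "((\<lambda>x. monomial n \<alpha> (\<lambda>k. z k + x * w k)) has_field_derivative
     (\<Sum>k<n. (of_nat (\<alpha> k) * z k ^ (\<alpha> k - 1) * w k) * ?r \<alpha> k)) (at 0)" for \<alpha>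
  proof -
    have "((\<lambda>x. (z k + x * w k) ^ \<alpha> k) has_field_derivative
        of_nat (\<alpha> k) * z k ^ (\<alpha> k - 1) * w k) (at 0)" for k
      by (auto intro!: derivative_eq_intros)
    then have "((\<lambda>x. \<Prod>k<n. (z k + x * w k) ^ \<alpha> k) has_derivative
        (\<lambda>y. \<Sum>k<n. (of_nat (\<alpha> k) * z k ^ (\<alpha> k - 1) * w k) * y *
          (\<Prod>j\<in>{..<n} - {k}. (z j + 0 * w j) ^ \<alpha> j))) (at 0)"
      unfolding has_field_derivative_def by (rule has_derivative_prod)
    then show ?thesis
      unfolding monomial_def has_field_derivative_def
      by (rule has_derivative_eq_rhs) (simp add: fun_eq_iff sum_distrib_left mult_ac)
  qed
  have "((\<lambda>x. hom_poly n (Suc m) c (\<lambda>k. z k + x * w k)) has_field_derivative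
     (\<Sum>\<alpha>\<in>multi_indices n (Suc m). c \<alpha> *
        (\<Sum>k<n. (of_nat (\<alpha> k) * z k ^ (\<alpha> k - 1) * w k) * ?r \<alpha> k))) (at 0)"
    unfolding hom_poly_def by (rule DERIV_sum, rule DERIV_cmult, rule mono)
  also have "(\<Sum>\<alpha>\<in>multi_indices n (Suc m). c \<alpha> *
        (\<Sum>k<n. (of_nat (\<alpha> k) * z k ^ (\<alpha> k - 1) * w k) * ?r \<alpha> k)) =
     (\<Sum>k<n. \<Sum>\<alpha>\<in>multi_indices n (Suc m).
        w k * (of_nat (\<alpha> k) * c \<alpha> * (z k ^ (\<alpha> k - 1) * ?r \<alpha> k)))"
    unfolding sum_distrib_left by (subst sum.swap) (simp add: mult_ac)
  also have "\<dots> = (\<Sum>k<n. w k * hom_poly n m (shift_coeffs k c) z)"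
  proof (intro sum.cong refl)
    fix k assume k: "k \<in> {..<n}"
    have "(\<Sum>\<alpha>\<in>multi_indices n (Suc m). w k * (of_nat (\<alpha> k) * c \<alpha> * (z k ^ (\<alpha> k - 1) * ?r \<alpha> k))) =
      (\<Sum>\<alpha> | \<alpha> \<in> multi_indices n (Suc m) \<and> \<alpha> k > 0.
        w k * (of_nat (\<alpha> k) * c \<alpha> * (z k ^ (\<alpha> k - 1) * ?r \<alpha> k)))"
      by (rule sum.mono_neutral_right) (auto simp: finite_multi_indices)
    also have "\<dots> = (\<Sum>\<beta>\<in>multi_indices n m. w k * (shift_coeffs k c \<beta> * monomial n \<beta> z))"
    proof (subst sum_multi_indices_incr)
      have "monomial n \<beta> z = z k ^ \<beta> k * ?r (\<beta>(k := Suc (\<beta> k))) k" for \<beta>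
        using k unfolding monomial_def by (subst prod.remove[of "{..<n}" k]) auto
      then show "(\<Sum>\<beta>\<in>multi_indices n m. w k * (of_nat ((\<beta>(k := Suc (\<beta> k))) k) *
          c (\<beta>(k := Suc (\<beta> k))) * (z k ^ ((\<beta>(k := Suc (\<beta> k))) k - 1) *
            ?r (\<beta>(k := Suc (\<beta> k))) k))) =
        (\<Sum>\<beta>\<in>multi_indices n m. w k * (shift_coeffs k c \<beta> * monomial n \<beta> z))"
        by (simp add: shift_coeffs_def)
    qed (use k in auto)
    finally show "(\<Sum>\<alpha>\<in>multi_indices n (Suc m).
        w k * (of_nat (\<alpha> k) * c \<alpha> * (z k ^ (\<alpha> k - 1) * ?r \<alpha> k))) =
      w k * hom_poly n m (shift_coeffs k c) z"
      by (simp add: hom_poly_def sum_distrib_left)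
  qed
  finally show ?thesis .
qed

lemma directional_derivative_bound:
  assumes "\<And>x. cmod x = 1 / real (Suc m) \<Longrightarrow>
    cmod (hom_poly n (Suc m) c (\<lambda>k. z k + x * w k)) \<le> B"
  shows "cmod (\<Sum>k<n. w k * hom_poly n m (shift_coeffs k c) z) \<le> real (Suc m) * B"
proof -
  let ?f = "\<lambda>x. hom_poly n (Suc m) c (\<lambda>k. z k + x * w k)"
  have holo: "?f holomorphic_on A" for A
    unfolding hom_poly_def monomial_def by (intro holomorphic_intros)
  have "cmod ((deriv ^^ 1) ?f 0) \<le> fact 1 * B / (1 / real (Suc m)) ^ 1"
    by (rule Cauchy_inequality)
      (use assms holo in \<open>auto intro: holomorphic_on_imp_continuous_on\<close>)
  moreover have "(deriv ^^ 1) ?f 0 = (\<Sum>k<n. w k * hom_poly n m (shift_coeffs k c) z)"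
    using DERIV_imp_deriv[OF hom_poly_line_has_derivative] by simp
  ultimately show ?thesis by (simp only: fact_1 power_one_right) (simp add: mult.commute)
qed

lemma cnj_sgn_mult: "cnj (sgn x) * x = of_real (cmod x)"
proof -
  have "cnj (sgn x) * x = (x * cnj x) / of_real (cmod x)" by (simp add: sgn_eq mult.commute)
  also have "\<dots> = of_real ((cmod x)\<^sup>2) / of_real (cmod x)" by (simp only: complex_norm_square)
  finally show ?thesis by (simp add: power2_eq_square)
qed

lemma sum_coeffs_le_sup_polydisc:
  assumes B: "\<And>z. z \<in> cvec n \<Longrightarrow> (\<And>k. k < n \<Longrightarrow> cmod (z k) \<le> 1) \<Longrightarrow>
    cmod (hom_poly n (Suc m) c z) \<le> B"
  shows "(\<Sum>\<alpha>\<in>multi_indices n (Suc m). cmod (c \<alpha>)) \<le>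
    sqrt (card (multi_indices n m)) * 2 ^ m * (real (Suc m) * (exp 1 * B))"
proof -
  define N where "N = Suc (2 * m)"
  define s where "s = 1 + 1 / real (Suc m)"
  let ?d = "\<lambda>k. shift_coeffs k c"
  let ?L = "sqrt (card (multi_indices n m))"
  have s: "s > 0" "s ^ Suc m \<le> exp 1"
    using exp_ge_one_plus_x_over_n_power_n[of "Suc m" 1] by (auto simp: s_def add_pos_nonneg)
  have "cmod (hom_poly n (Suc m) c (\<lambda>_. 0)) \<le> B" by (rule B) (auto simp: cvec_def)
  then have B0: "B \<ge> 0" using norm_ge_zero order_trans by blast
  have grad: "(\<Sum>k<n. cmod (hom_poly n m (?d k) z)) \<le> real (Suc m) * (exp 1 * B)"
    if z: "z \<in> cvec n" "\<And>k. k < n \<Longrightarrow> cmod (z k) \<le> 1" for z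
  proof -
    define w where "w k = (if k < n then cnj (sgn (hom_poly n m (?d k) z)) else 0)" for k
    have w1: "cmod (w k) \<le> 1" for k by (simp add: w_def norm_sgn)
    have w: "w k * hom_poly n m (?d k) z = of_real (cmod (hom_poly n m (?d k) z))" if "k < n" for k
      using that by (simp add: w_def cnj_sgn_mult)
    have "cmod (\<Sum>k<n. w k * hom_poly n m (?d k) z) \<le> real (Suc m) * (exp 1 * B)"
    proof (rule directional_derivative_bound)
      fix x assume x: "cmod x = 1 / real (Suc m)"
      define y where "y k = (z k + x * w k) / of_real s" for k
      have "cmod (z k + x * w k) \<le> s" if "k < n" for k
      proof -
        have "cmod (z k + x * w k) \<le> cmod (z k) + cmod x * cmod (w k)"
          by (metis norm_mult norm_triangle_ineq)
        also have "\<dots> \<le> 1 + cmod x * 1"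
          using z(2)[OF that] w1 by (intro add_mono mult_left_mono) auto
        finally show ?thesis using x by (simp add: s_def)
      qed
      then have "cmod (hom_poly n (Suc m) c y) \<le> B"
        using s z by (intro B) (auto simp: y_def cvec_def w_def norm_divide)
      have "(\<lambda>k. z k + x * w k) = (\<lambda>k. of_real s * y k)"
        using s by (auto simp: y_def)
      then have "cmod (hom_poly n (Suc m) c (\<lambda>k. z k + x * w k)) =
          s ^ Suc m * cmod (hom_poly n (Suc m) c y)"
        using s by (simp add: hom_poly_const_mult norm_mult norm_power)
      also have "\<dots> \<le> exp 1 * B"
        using s \<open>cmod (hom_poly n (Suc m) c y) \<le> B\<close> by (intro mult_mono) auto
      finally show "cmod (hom_poly n (Suc m) c (\<lambda>k. z k + x * w k)) \<le> exp 1 * B" .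
    qed
    also have "(\<Sum>k<n. w k * hom_poly n m (?d k) z) =
        of_real (\<Sum>k<n. cmod (hom_poly n m (?d k) z))"
      by (simp add: w)
    finally show ?thesis by (simp add: sum_nonneg del: of_real_sum)
  qed
  have coeffs: "(\<Sum>\<beta>\<in>multi_indices n m. cmod (c (\<beta>(k := Suc (\<beta> k))))) \<le>
      ?L * sqrt (\<Sum>\<beta>\<in>multi_indices n m. (cmod (?d k \<beta>))\<^sup>2)" for k
  proof -
    have "(\<Sum>\<beta>\<in>multi_indices n m. cmod (c (\<beta>(k := Suc (\<beta> k))))) \<le>
        (\<Sum>\<beta>\<in>multi_indices n m. 1 * cmod (?d k \<beta>))"
    proof (rule sum_mono)
      fix \<beta>
      show "cmod (c (\<beta>(k := Suc (\<beta> k)))) \<le> 1 * cmod (?d k \<beta>)"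
        using mult_right_mono[of 1 "real (Suc (\<beta> k))" "cmod (c (\<beta>(k := Suc (\<beta> k))))"]
        by (simp only: shift_coeffs_def norm_mult norm_of_nat) simp
    qed
    also have "\<dots> \<le> sqrt ((\<Sum>\<beta>\<in>multi_indices n m. 1\<^sup>2) * (\<Sum>\<beta>\<in>multi_indices n m. (cmod (?d k \<beta>))\<^sup>2))"
      by (rule real_le_rsqrt, rule Cauchy_Schwarz_ineq_sum)
    finally show ?thesis by (simp add: real_sqrt_mult)
  qed
  have "real (N ^ n) * (\<Sum>\<alpha>\<in>multi_indices n (Suc m). cmod (c \<alpha>)) \<le>
      real (N ^ n) * (\<Sum>k<n. ?L * sqrt (\<Sum>\<beta>\<in>multi_indices n m. (cmod (?d k \<beta>))\<^sup>2))"
    by (intro mult_left_mono order_trans[OF sum_multi_indices_Suc_le] sum_mono coeffs) auto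
  also have "\<dots> = (\<Sum>k<n. ?L * (real (N ^ n) * sqrt (\<Sum>\<beta>\<in>multi_indices n m. (cmod (?d k \<beta>))\<^sup>2)))"
    by (simp add: sum_distrib_left mult_ac)
  also have "\<dots> \<le> (\<Sum>k<n. ?L * (2 ^ m * (\<Sum>t\<in>grid n N. cmod (hom_poly n m (?d k) (grid_point n N t)))))"
    by (intro sum_mono mult_left_mono l2_coeff_le_l1_grid) (auto simp: N_def)
  also have "\<dots> = ?L * 2 ^ m * (\<Sum>t\<in>grid n N. \<Sum>k<n. cmod (hom_poly n m (?d k) (grid_point n N t)))"
    by (subst sum.swap) (simp add: sum_distrib_left mult_ac)
  also have "\<dots> \<le> ?L * 2 ^ m * (\<Sum>t\<in>grid n N. real (Suc m) * (exp 1 * B))"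
    by (intro mult_left_mono sum_mono grad) (auto simp: grid_point_in_cvec cmod_grid_point)
  also have "\<dots> = real (N ^ n) * (?L * 2 ^ m * (real (Suc m) * (exp 1 * B)))"
    by (simp add: card_grid mult_ac)
  finally show ?thesis by (simp only: N_def mult_le_cancel_left_pos of_nat_0_less_iff zero_less_power zero_less_Suc)
qed

section \<open>The unit ball of \<open>\<ell>\<^sub>q\<^sup>n\<close>\<close>

lemma power_powr_commute: "(a powr s) ^ k = (a ^ k) powr s" for a s :: real
  by (induction k) (simp_all add: powr_mult)

lemma convex_combination_powr_le:
  fixes x y t q :: real
  assumes "0 \<le> x" "0 \<le> y" "0 \<le> t" "t \<le> 1" "1 \<le> q"
  shows "((1 - t) * x + t * y) powr q \<le> (1 - t) * x powr q + t * y powr q"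
proof -
  have scale: "(s * v) powr q \<le> s * v powr q" if "0 \<le> s" "s \<le> 1" "0 \<le> v" for s v :: real
  proof -
    have "s powr q \<le> s powr 1" using that assms by (intro powr_mono') auto
    then show ?thesis using that by (simp add: powr_mult mult_right_mono)
  qed
  consider "x = 0" | "y = 0" | "x > 0" "y > 0" using assms by linarith
  then show ?thesis
  proof cases
    case 3
    then show ?thesis using convex_onD[OF powr_convex[OF \<open>1 \<le> q\<close>], of t x y] assms by simp
  qed (use scale[of t y] scale[of "1 - t" x] assms in simp_all)
qed

lemma sum_powr_cmod_add_le:
  assumes "1 \<le> q" "0 \<le> r" "cmod x \<le> r"
    and z: "(\<Sum>k<n. cmod (z k) powr q) \<le> 1" and w: "(\<Sum>k<n. cmod (w k) powr q) \<le> 1"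
  shows "(\<Sum>k<n. cmod (z k + x * w k) powr q) \<le> (1 + r) powr q"
proof -
  define t where "t = r / (1 + r)"
  have t: "0 \<le> t" "t \<le> 1" "(1 + r) * (1 - t) = 1" "(1 + r) * t = r"
    using assms by (auto simp: t_def field_simps)
  have "cmod (z k + x * w k) powr q \<le>
      (1 + r) powr q * ((1 - t) * cmod (z k) powr q + t * cmod (w k) powr q)" for k
  proof -
    have "cmod (z k + x * w k) \<le> cmod (z k) + r * cmod (w k)"
      using norm_triangle_ineq[of "z k" "x * w k"] mult_right_mono[OF assms(3), of "cmod (w k)"]
      by (simp add: norm_mult)
    also have "\<dots> = (1 + r) * (1 - t) * cmod (z k) + (1 + r) * t * cmod (w k)"
      using t by simp
    also have "\<dots> = (1 + r) * ((1 - t) * cmod (z k) + t * cmod (w k))"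
      by (simp add: algebra_simps)
    finally have "cmod (z k + x * w k) powr q \<le>
        ((1 + r) * ((1 - t) * cmod (z k) + t * cmod (w k))) powr q"
      using assms by (intro powr_mono2) auto
    also have "\<dots> = (1 + r) powr q * ((1 - t) * cmod (z k) + t * cmod (w k)) powr q"
      by (rule powr_mult)
    also have "\<dots> \<le> (1 + r) powr q * ((1 - t) * cmod (z k) powr q + t * cmod (w k) powr q)"
      using t assms by (intro mult_left_mono convex_combination_powr_le) auto
    finally show ?thesis .
  qed
  then have "(\<Sum>k<n. cmod (z k + x * w k) powr q) \<le>
      (\<Sum>k<n. (1 + r) powr q * ((1 - t) * cmod (z k) powr q + t * cmod (w k) powr q))"
    by (rule sum_mono)
  also have "\<dots> = (1 + r) powr q *
      ((1 - t) * (\<Sum>k<n. cmod (z k) powr q) + t * (\<Sum>k<n. cmod (w k) powr q))"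
    by (simp add: sum.distrib flip: sum_distrib_left)
  also have "\<dots> \<le> (1 + r) powr q * ((1 - t) * 1 + t * 1)"
    using t z w by (intro mult_left_mono add_mono) auto
  finally show ?thesis by simp
qed

lemma sum_powr_inverse_le:
  fixes x :: "'a \<Rightarrow> real"
  assumes "finite A" "\<And>i. i \<in> A \<Longrightarrow> 0 \<le> x i" "sum x A \<le> 1" "1 \<le> q"
  shows "(\<Sum>i\<in>A. x i powr (1 / q)) \<le> real (card A) powr (1 - 1 / q)"
proof (cases "A = {}")
  case False
  define L where "L = real (card A)"
  have L: "L > 0" using False assms by (simp add: L_def card_gt_0_iff)
  define \<theta> where "\<theta> = 1 / q"
  have \<theta>: "0 < \<theta>" "\<theta> \<le> 1" using assms by (auto simp: \<theta>_def)
  have "x i powr \<theta> \<le> (\<theta> * (x i * L) + (1 - \<theta>)) * L powr - \<theta>" if "i \<in> A" for i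
  proof -
    have "(x i * L) powr \<theta> \<le> \<theta> * (x i * L) + (1 - \<theta>)"
    proof (cases "x i = 0")
      case False
      then have "x i * L > 0" using assms(2)[OF that] L by simp
      then show ?thesis using Youngs_inequality_0[of \<theta> "1 - \<theta>" "x i * L" 1] \<theta> by simp
    qed (use \<theta> in simp)
    then have "(x i * L) powr \<theta> * L powr - \<theta> \<le> (\<theta> * (x i * L) + (1 - \<theta>)) * L powr - \<theta>"
      by (intro mult_right_mono) auto
    moreover have "(x i * L) powr \<theta> * L powr - \<theta> = x i powr \<theta>"
      using assms(2)[OF that] L by (simp add: powr_mult powr_minus)
    ultimately show ?thesis by simp
  qed
  then have "(\<Sum>i\<in>A. x i powr \<theta>) \<le> (\<Sum>i\<in>A. (\<theta> * (x i * L) + (1 - \<theta>)) * L powr - \<theta>)"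
    by (rule sum_mono)
  also have "\<dots> = (\<theta> * L * sum x A + (1 - \<theta>) * L) * L powr - \<theta>"
    by (simp add: L_def sum.distrib mult_ac flip: sum_distrib_right sum_distrib_left)
  also have "\<dots> \<le> (\<theta> * L * 1 + (1 - \<theta>) * L) * L powr - \<theta>"
    using \<theta> L assms by (intro mult_right_mono add_mono mult_left_mono) auto
  also have "\<dots> = L powr (1 - \<theta>)"
    using L by (simp add: powr_diff powr_minus field_simps)
  finally show ?thesis by (simp add: \<theta>_def L_def)
qed simp

definition multinom :: "nat \<Rightarrow> nat \<Rightarrow> (nat \<Rightarrow> nat) \<Rightarrow> real" where
  "multinom n m \<beta> = fact m / (\<Prod>k<n. fact (\<beta> k))"

lemma multinom_pos: "multinom n m \<beta> > 0"
  by (simp add: multinom_def prod_pos)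

lemma multinom_incr:
  assumes "k < n"
  shows "real (Suc (\<beta> k)) * multinom n (Suc m) (\<beta>(k := Suc (\<beta> k))) =
    real (Suc m) * multinom n m \<beta>"
proof -
  have "(\<Prod>i<n. fact ((\<beta>(k := Suc (\<beta> k))) i) :: real) = real (Suc (\<beta> k)) * (\<Prod>i<n. fact (\<beta> i))"
    using assms by (subst (1 2) prod.remove[of "{..<n}" k]) auto
  then show ?thesis
    unfolding multinom_def by (simp del: of_nat_Suc add: field_simps prod_pos)
qed

lemma multinomial_sum:
  fixes x :: "nat \<Rightarrow> real"
  shows "(\<Sum>\<beta>\<in>multi_indices n m. multinom n m \<beta> * (\<Prod>k<n. x k ^ \<beta> k)) = (\<Sum>k<n. x k) ^ m"
proof (induction m)
  case 0
  have "multi_indices n 0 = {\<lambda>_. 0}"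
    by (auto simp: multi_indices_def fun_eq_iff) (metis lessThan_iff not_le)
  then show ?case by (simp add: multinom_def)
next
  case (Suc m)
  let ?f = "\<lambda>m \<beta>. multinom n m \<beta> * (\<Prod>k<n. x k ^ \<beta> k)"
  have "real (Suc m) * (\<Sum>\<alpha>\<in>multi_indices n (Suc m). ?f (Suc m) \<alpha>) =
      (\<Sum>\<alpha>\<in>multi_indices n (Suc m). \<Sum>k<n. real (\<alpha> k) * ?f (Suc m) \<alpha>)"
    unfolding sum_distrib_left
  proof (rule sum.cong[OF refl])
    fix \<alpha> assume "\<alpha> \<in> multi_indices n (Suc m)"
    then have "real (Suc m) = (\<Sum>k<n. real (\<alpha> k))"
      by (simp only: multi_indices_def mem_Collect_eq flip: of_nat_sum)
    then show "real (Suc m) * ?f (Suc m) \<alpha> = (\<Sum>k<n. real (\<alpha> k) * ?f (Suc m) \<alpha>)"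
      by (simp only: sum_distrib_right)
  qed
  also have "\<dots> = (\<Sum>k<n. \<Sum>\<alpha>\<in>multi_indices n (Suc m). real (\<alpha> k) * ?f (Suc m) \<alpha>)"
    by (rule sum.swap)
  also have "\<dots> = (\<Sum>k<n. x k * (real (Suc m) * (\<Sum>\<beta>\<in>multi_indices n m. ?f m \<beta>)))"
  proof (rule sum.cong[OF refl])
    fix k assume "k \<in> {..<n}"
    then have k: "k < n" by simp
    have "(\<Sum>\<alpha>\<in>multi_indices n (Suc m). real (\<alpha> k) * ?f (Suc m) \<alpha>) =
        (\<Sum>\<alpha> | \<alpha> \<in> multi_indices n (Suc m) \<and> \<alpha> k > 0. real (\<alpha> k) * ?f (Suc m) \<alpha>)"
      by (rule sum.mono_neutral_right) (auto simp: finite_multi_indices)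
    also have "\<dots> = (\<Sum>\<beta>\<in>multi_indices n m. x k * (real (Suc m) * ?f m \<beta>))"
      unfolding sum_multi_indices_incr[OF k]
    proof (rule sum.cong[OF refl])
      fix \<beta>
      let ?\<alpha> = "\<beta>(k := Suc (\<beta> k))"
      have "(\<Prod>i<n. x i ^ ?\<alpha> i) = x k * (\<Prod>i<n. x i ^ \<beta> i)"
        using k by (subst (1 2) prod.remove[of "{..<n}" k]) auto
      then have "real (?\<alpha> k) * ?f (Suc m) ?\<alpha> =
          (real (Suc (\<beta> k)) * multinom n (Suc m) ?\<alpha>) * (x k * (\<Prod>i<n. x i ^ \<beta> i))"
        by (simp only: fun_upd_same mult.assoc)
      then show "real (?\<alpha> k) * ?f (Suc m) ?\<alpha> = x k * (real (Suc m) * ?f m \<beta>)"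
        by (simp only: multinom_incr[OF k] mult_ac)
    qed
    finally show "(\<Sum>\<alpha>\<in>multi_indices n (Suc m). real (\<alpha> k) * ?f (Suc m) \<alpha>) =
        x k * (real (Suc m) * (\<Sum>\<beta>\<in>multi_indices n m. ?f m \<beta>))"
      by (simp only: sum_distrib_left)
  qed
  also have "\<dots> = real (Suc m) * (\<Sum>k<n. x k) ^ Suc m"
    unfolding Suc.IH by (simp del: of_nat_Suc flip: sum_distrib_right)
  finally show ?case by (simp del: of_nat_Suc)
qed

lemma power_self_le_exp_mult_fact: "real m ^ m \<le> exp (real m) * fact m"
proof -
  have "real m ^ m /\<^sub>R fact m \<le> exp (real m)"
    unfolding exp_def
    using sum_le_suminf[OF summable_exp_generic[of "real m"], of "{m}"] by simp
  then show ?thesis by (simp add: divide_simps mult.commute)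
qed

lemma multinom_prod_power_ge:
  assumes "\<beta> \<in> multi_indices n m"
  shows "1 \<le> exp (real m) * multinom n m \<beta> * (\<Prod>k<n. (real (\<beta> k) / real m) ^ \<beta> k)"
proof -
  define F where "F = (\<Prod>k<n. fact (\<beta> k) :: real)"
  define D where "D = (\<Prod>k<n. real (\<beta> k) ^ \<beta> k)"
  have F: "F > 0" by (simp add: F_def prod_pos)
  have m: "real m ^ m > 0" by (cases m) auto
  have "(\<Prod>k<n. (real (\<beta> k) / real m) ^ \<beta> k) = D / (\<Prod>k<n. real m ^ \<beta> k)"
    by (simp add: D_def power_divide prod_dividef)
  also have "(\<Prod>k<n. real m ^ \<beta> k) = real m ^ m"
    using assms by (simp add: multi_indices_def flip: power_sum)
  finally have eq: "exp (real m) * multinom n m \<beta> * (\<Prod>k<n. (real (\<beta> k) / real m) ^ \<beta> k) =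
      (exp (real m) * fact m * D) / (real m ^ m * F)"
    by (simp add: multinom_def F_def)
  have "F \<le> D"
    unfolding F_def D_def by (intro prod_mono) (use fact_le_power[where 'a = real] in simp)
  then have "real m ^ m * F \<le> exp (real m) * fact m * D"
    using F by (intro mult_mono power_self_le_exp_mult_fact) auto
  then show ?thesis unfolding eq using F m by simp
qed

lemma sum_coeffs_le_sup_lq_ball:
  assumes q: "1 \<le> q"
    and B: "\<And>z. z \<in> cvec n \<Longrightarrow> (\<Sum>k<n. cmod (z k) powr q) < 1 \<Longrightarrow>
      cmod (hom_poly n (Suc m) c z) \<le> B"
    and u: "(\<Sum>k<n. cmod (u k) powr q) \<le> 1"
  shows "(\<Sum>\<alpha>\<in>multi_indices n (Suc m). cmod (c \<alpha>) * cmod (monomial n \<alpha> u)) \<le>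
    real (Suc m) * (exp 2 * B) * exp (real m) * real (card (multi_indices n m)) powr (1 - 1 / q)"
proof -
  define s where "s = 1 + 2 / real (Suc m)"
  define K where "K = real (Suc m) * (exp 2 * B)"
  have s: "s > 0" "s ^ Suc m \<le> exp 2"
    using exp_ge_one_plus_x_over_n_power_n[of "Suc m" 2] by (auto simp: s_def add_pos_nonneg)
  have "cmod (hom_poly n (Suc m) c (\<lambda>_. 0)) \<le> B"
    using q by (intro B) (auto simp: cvec_def)
  then have B0: "B \<ge> 0" using norm_ge_zero order_trans by blast
  have grad: "cmod (\<Sum>k<n. w k * hom_poly n m (shift_coeffs k c) z) \<le> K"
    if z: "z \<in> cvec n" "(\<Sum>k<n. cmod (z k) powr q) \<le> 1"
      and w: "w \<in> cvec n" "(\<Sum>k<n. cmod (w k) powr q) \<le> 1" for z w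
    unfolding K_def
  proof (rule directional_derivative_bound)
    fix x assume x: "cmod x = 1 / real (Suc m)"
    define y where "y k = (z k + x * w k) / of_real s" for k
    have "(\<Sum>k<n. cmod (y k) powr q) = (\<Sum>k<n. cmod (z k + x * w k) powr q) / s powr q"
      using s unfolding y_def by (simp add: norm_divide powr_divide sum_divide_distrib)
    also have "\<dots> \<le> (1 + 1 / real (Suc m)) powr q / s powr q"
      using sum_powr_cmod_add_le[OF q _ eq_refl[OF x] z(2) w(2)] by (intro divide_right_mono) auto
    also have "\<dots> < 1"
    proof -
      have "1 + 1 / real (Suc m) < s" unfolding s_def by (simp add: divide_strict_right_mono)
      then have "(1 + 1 / real (Suc m)) powr q < s powr q"
        using q by (intro powr_less_mono2) auto
      then show ?thesis using s by simp
    qed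
    finally have y: "cmod (hom_poly n (Suc m) c y) \<le> B"
      using z w by (intro B) (auto simp: y_def cvec_def)
    have "(\<lambda>k. z k + x * w k) = (\<lambda>k. of_real s * y k)"
      using s by (auto simp: y_def)
    then have "cmod (hom_poly n (Suc m) c (\<lambda>k. z k + x * w k)) =
        s ^ Suc m * cmod (hom_poly n (Suc m) c y)"
      using s by (simp add: hom_poly_const_mult norm_mult norm_power)
    also have "\<dots> \<le> exp 2 * B" using s y by (intro mult_mono) auto
    finally show "cmod (hom_poly n (Suc m) c (\<lambda>k. z k + x * w k)) \<le> exp 2 * B" .
  qed
  have slice: "(\<Sum>k<n. cmod (u k) * cmod (c (\<beta>(k := Suc (\<beta> k))))) \<le>
      K * (exp (real m) * multinom n m \<beta>) powr (1 / q)"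
    if \<beta>: "\<beta> \<in> multi_indices n m" for \<beta>
  proof -
    define w where "w k = (if k < n then of_real (cmod (u k)) * cnj (sgn (c (\<beta>(k := Suc (\<beta> k))))) else 0)" for k
    define r where "r k = (real (\<beta> k) / real m) powr (1 / q)" for k
    define X where "X = (\<Sum>k<n. cmod (u k) * cmod (c (\<beta>(k := Suc (\<beta> k)))))"
    have w: "w \<in> cvec n" "(\<Sum>k<n. cmod (w k) powr q) \<le> 1"
    proof -
      have "(\<Sum>k<n. cmod (w k) powr q) \<le> (\<Sum>k<n. cmod (u k) powr q)"
        using q by (intro sum_mono powr_mono2) (auto simp: w_def norm_mult norm_sgn)
      then show "(\<Sum>k<n. cmod (w k) powr q) \<le> 1" using u by simp
    qed (simp add: w_def cvec_def)
    have r: "(\<Sum>k<n. r k powr q) \<le> 1"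
    proof -
      have "(\<Sum>k<n. r k powr q) = (\<Sum>k<n. real (\<beta> k) / real m)"
        using q by (simp add: r_def powr_powr)
      also have "\<dots> = real m / real m"
        using \<beta> by (simp add: multi_indices_def flip: sum_divide_distrib of_nat_sum)
      finally show ?thesis by simp
    qed
    have "cmod (\<Sum>k<n. w k * shift_coeffs k c \<beta>) * (\<Prod>k<n. r k ^ \<beta> k) \<le> K"
    proof (rule coeff_bound[where a = "\<lambda>\<beta>. \<Sum>k<n. w k * shift_coeffs k c \<beta>", OF _ _ \<beta>])
      fix z assume z: "z \<in> cvec n" "\<And>k. k < n \<Longrightarrow> cmod (z k) = r k"
      have "hom_poly n m (\<lambda>\<beta>. \<Sum>k<n. w k * shift_coeffs k c \<beta>) z =
          (\<Sum>k<n. w k * hom_poly n m (shift_coeffs k c) z)"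
        unfolding hom_poly_def sum_distrib_right sum_distrib_left
        by (subst sum.swap) (simp only: mult.assoc)
      then show "cmod (hom_poly n m (\<lambda>\<beta>. \<Sum>k<n. w k * shift_coeffs k c \<beta>) z) \<le> K"
        using grad[OF z(1) _ w] z(2) r by simp
    qed (simp add: r_def)
    moreover have "X \<le> cmod (\<Sum>k<n. w k * shift_coeffs k c \<beta>)"
    proof -
      let ?v = "\<lambda>k. real (Suc (\<beta> k)) * (cmod (u k) * cmod (c (\<beta>(k := Suc (\<beta> k)))))"
      have "w k * shift_coeffs k c \<beta> = of_real (?v k)" if "k < n" for k
      proof -
        have "w k * shift_coeffs k c \<beta> = of_nat (Suc (\<beta> k)) * (of_real (cmod (u k)) *
            (cnj (sgn (c (\<beta>(k := Suc (\<beta> k))))) * c (\<beta>(k := Suc (\<beta> k)))))"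
          using that by (simp add: w_def shift_coeffs_def mult_ac del: of_nat_Suc)
        then show ?thesis by (simp only: cnj_sgn_mult of_real_mult of_real_of_nat_eq)
      qed
      then have "(\<Sum>k<n. w k * shift_coeffs k c \<beta>) = of_real (\<Sum>k<n. ?v k)" by simp
      then have "cmod (\<Sum>k<n. w k * shift_coeffs k c \<beta>) = \<bar>\<Sum>k<n. ?v k\<bar>"
        by (simp only: norm_of_real)
      moreover have "X \<le> (\<Sum>k<n. ?v k)"
        unfolding X_def
      proof (rule sum_mono)
        fix k
        show "cmod (u k) * cmod (c (\<beta>(k := Suc (\<beta> k)))) \<le> ?v k"
          using mult_right_mono[of 1 "real (Suc (\<beta> k))" "cmod (u k) * cmod (c (\<beta>(k := Suc (\<beta> k))))"]
          by simp
      qed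
      ultimately show ?thesis by linarith
    qed
    moreover have "(\<Prod>k<n. r k ^ \<beta> k) \<ge> 0" by (simp add: r_def prod_nonneg)
    ultimately have XK: "X * (\<Prod>k<n. r k ^ \<beta> k) \<le> K"
      by (meson mult_right_mono order_trans)
    let ?W = "exp (real m) * multinom n m \<beta>"
    have W: "?W > 0" by (simp add: multinom_pos)
    have "(\<Prod>k<n. r k ^ \<beta> k) = (\<Prod>k<n. (real (\<beta> k) / real m) ^ \<beta> k) powr (1 / q)"
      by (simp only: r_def power_powr_commute prod_powr_distrib)
    then have "1 \<le> ?W powr (1 / q) * (\<Prod>k<n. r k ^ \<beta> k)"
      using powr_mono2[OF _ _ multinom_prod_power_ge[OF \<beta>], of "1 / q"] q W
      by (simp add: powr_mult prod_nonneg)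
    moreover have "X \<ge> 0" by (auto simp: X_def intro: sum_nonneg)
    ultimately have "X * 1 \<le> X * (?W powr (1 / q) * (\<Prod>k<n. r k ^ \<beta> k))"
      by (intro mult_left_mono) auto
    also have "\<dots> = ?W powr (1 / q) * (X * (\<Prod>k<n. r k ^ \<beta> k))" by simp
    also have "\<dots> \<le> ?W powr (1 / q) * K" using XK by (intro mult_left_mono) auto
    finally show ?thesis by (simp add: X_def mult.commute)
  qed
  have K0: "K \<ge> 0" using B0 by (simp add: K_def)
  define x where "x \<beta> = multinom n m \<beta> * (\<Prod>k<n. (cmod (u k) powr q) ^ \<beta> k)" for \<beta>
  have x0: "x \<beta> \<ge> 0" for \<beta>
    by (auto simp: x_def less_imp_le[OF multinom_pos] intro!: mult_nonneg_nonneg prod_nonneg)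
  have x1: "sum x (multi_indices n m) \<le> 1"
    unfolding x_def multinomial_sum using u by (intro power_le_one) (auto intro: sum_nonneg)
  have xpow: "multinom n m \<beta> powr (1 / q) * cmod (monomial n \<beta> u) = x \<beta> powr (1 / q)" for \<beta>
  proof -
    have "(cmod (u k) ^ \<beta> k) = ((cmod (u k) powr q) ^ \<beta> k) powr (1 / q)" for k
      using q by (simp add: powr_powr flip: power_powr_commute)
    then have "cmod (monomial n \<beta> u) = (\<Prod>k<n. (cmod (u k) powr q) ^ \<beta> k) powr (1 / q)"
      by (simp add: cmod_monomial prod_powr_distrib)
    then show ?thesis
      by (simp add: x_def powr_mult prod_nonneg less_imp_le[OF multinom_pos])
  qed
  have "(\<Sum>\<alpha>\<in>multi_indices n (Suc m). cmod (c \<alpha>) * cmod (monomial n \<alpha> u)) \<le>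
      (\<Sum>k<n. \<Sum>\<beta>\<in>multi_indices n m. cmod (c (\<beta>(k := Suc (\<beta> k)))) *
        cmod (monomial n (\<beta>(k := Suc (\<beta> k))) u))"
    by (rule sum_multi_indices_Suc_le) simp
  also have "\<dots> = (\<Sum>k<n. \<Sum>\<beta>\<in>multi_indices n m. cmod (monomial n \<beta> u) *
        (cmod (u k) * cmod (c (\<beta>(k := Suc (\<beta> k))))))"
  proof (intro sum.cong refl)
    fix k \<beta> assume k: "k \<in> {..<n}"
    have "monomial n (\<beta>(k := Suc (\<beta> k))) u = u k * monomial n \<beta> u"
      using k unfolding monomial_def by (subst (1 2) prod.remove[of "{..<n}" k]) auto
    then show "cmod (c (\<beta>(k := Suc (\<beta> k)))) * cmod (monomial n (\<beta>(k := Suc (\<beta> k))) u) =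
        cmod (monomial n \<beta> u) * (cmod (u k) * cmod (c (\<beta>(k := Suc (\<beta> k)))))"
      by (simp only: norm_mult mult_ac)
  qed
  also have "\<dots> = (\<Sum>\<beta>\<in>multi_indices n m. cmod (monomial n \<beta> u) *
        (\<Sum>k<n. cmod (u k) * cmod (c (\<beta>(k := Suc (\<beta> k))))))"
    unfolding sum_distrib_left by (rule sum.swap)
  also have "\<dots> \<le> (\<Sum>\<beta>\<in>multi_indices n m. cmod (monomial n \<beta> u) *
        (K * (exp (real m) * multinom n m \<beta>) powr (1 / q)))"
    by (intro sum_mono mult_left_mono slice) auto
  also have "\<dots> = K * exp (real m) powr (1 / q) * (\<Sum>\<beta>\<in>multi_indices n m. x \<beta> powr (1 / q))"
    unfolding sum_distrib_left
    by (intro sum.cong refl) (simp add: powr_mult less_imp_le[OF multinom_pos] mult_ac flip: xpow)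
  also have "\<dots> \<le> K * exp (real m) * real (card (multi_indices n m)) powr (1 - 1 / q)"
  proof (intro mult_mono mult_left_mono)
    have "exp (real m) powr (1 / q) \<le> exp (real m) powr 1"
      using q by (intro powr_mono) auto
    then show "exp (real m) powr (1 / q) \<le> exp (real m)" by simp
    show "(\<Sum>\<beta>\<in>multi_indices n m. x \<beta> powr (1 / q)) \<le> real (card (multi_indices n m)) powr (1 - 1 / q)"
      by (rule sum_powr_inverse_le) (use x0 x1 q finite_multi_indices in auto)
  qed (use K0 in \<open>auto intro: sum_nonneg\<close>)
  finally show ?thesis by (simp add: K_def)
qed

section \<open>The unconditional basis constant\<close>

lemma lp_norm_lt_1_iff:
  assumes "1 \<le> q"
  shows "lp_norm (ereal q) n z < 1 \<longleftrightarrow> (\<Sum>k<n. cmod (z k) powr q) < 1"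
proof -
  have S: "0 \<le> (\<Sum>k<n. cmod (z k) powr q)" by (simp add: sum_nonneg)
  have "x powr (1 / q) < 1 \<longleftrightarrow> x < 1" if "0 \<le> x" for x :: real
    using that assms ge_one_powr_ge_zero[of x "1 / q"] powr_less_mono2[of "1 / q" x 1]
    by (cases "x < 1") auto
  then show ?thesis using S by (simp add: lp_norm_def)
qed

lemma lp_norm_mono:
  assumes "1 \<le> p" "1 \<le> n" "\<And>k. k < n \<Longrightarrow> cmod (x k) \<le> cmod (y k)"
  shows "lp_norm p n x \<le> lp_norm p n y"
proof (cases "p = \<infinity>")
  case True
  have "Max ((\<lambda>k. cmod (x k)) ` {..<n}) \<le> Max ((\<lambda>k. cmod (y k)) ` {..<n})"
  proof (rule Max.boundedI)
    show "(\<lambda>k. cmod (x k)) ` {..<n} \<noteq> {}" using assms(2) by (auto simp: lessThan_empty_iff)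
    show "v \<le> Max ((\<lambda>k. cmod (y k)) ` {..<n})" if v: "v \<in> (\<lambda>k. cmod (x k)) ` {..<n}" for v
    proof -
      obtain k where "k < n" "v = cmod (x k)" using v by auto
      moreover have "cmod (y k) \<le> Max ((\<lambda>k. cmod (y k)) ` {..<n})"
        using \<open>k < n\<close> by (intro Max_ge) auto
      ultimately show ?thesis using assms(3)[of k] by (metis order_trans)
    qed
  qed simp
  then show ?thesis using True by (simp add: lp_norm_def)
next
  case False
  then obtain q where q: "p = ereal q" "1 \<le> q" using assms by (cases p) auto
  then show ?thesis
    using assms(3) by (auto simp: lp_norm_def intro!: powr_mono2 sum_mono sum_nonneg)
qed

lemma norm_hom_poly_le_poly_norm:
  assumes "1 \<le> p" "z \<in> unit_ball n (lp_norm p n)"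
  shows "cmod (hom_poly n m a z) \<le> poly_norm n m (lp_norm p n) a"
  unfolding poly_norm_def using assms by (intro cSUP_upper bdd_above_hom_poly)

lemma chi_mon_lp_le:
  assumes "1 \<le> p" "1 \<le> n" "1 \<le> K"
    and le: "\<And>a u. u \<in> unit_ball n (lp_norm p n) \<Longrightarrow>
      (\<Sum>\<alpha>\<in>multi_indices n m. cmod (a \<alpha>) * cmod (monomial n \<alpha> u)) \<le>
        K * poly_norm n m (lp_norm p n) a"
  shows "chi_mon n m (lp_norm p n) \<le> ereal K"
  unfolding chi_mon_def
proof (rule Inf_lower, intro CollectI exI conjI allI impI refl)
  fix a \<epsilon> :: "(nat \<Rightarrow> nat) \<Rightarrow> complex"
  assume \<epsilon>: "\<forall>\<alpha>\<in>multi_indices n m. cmod (\<epsilon> \<alpha>) \<le> 1"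
  show "poly_norm n m (lp_norm p n) (\<lambda>\<alpha>. \<epsilon> \<alpha> * a \<alpha>) \<le> K * poly_norm n m (lp_norm p n) a"
    unfolding poly_norm_def[of _ _ _ "\<lambda>\<alpha>. \<epsilon> \<alpha> * a \<alpha>"]
  proof (rule cSUP_least)
    show "unit_ball n (lp_norm p n) \<noteq> {}" using zero_in_unit_ball_lp assms by blast
  next
    fix u assume u: "u \<in> unit_ball n (lp_norm p n)"
    have "cmod (hom_poly n m (\<lambda>\<alpha>. \<epsilon> \<alpha> * a \<alpha>) u) \<le>
        (\<Sum>\<alpha>\<in>multi_indices n m. cmod (a \<alpha>) * cmod (monomial n \<alpha> u))"
      unfolding hom_poly_def
    proof (rule sum_norm_le)
      fix \<alpha> assume "\<alpha> \<in> multi_indices n m"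
      then show "cmod (\<epsilon> \<alpha> * a \<alpha> * monomial n \<alpha> u) \<le> cmod (a \<alpha>) * cmod (monomial n \<alpha> u)"
        using \<epsilon> mult_right_mono[of "cmod (\<epsilon> \<alpha>)" 1 "cmod (a \<alpha>) * cmod (monomial n \<alpha> u)"]
        by (simp add: norm_mult mult.assoc)
    qed
    also have "\<dots> \<le> K * poly_norm n m (lp_norm p n) a" using u by (rule le)
    finally show "cmod (hom_poly n m (\<lambda>\<alpha>. \<epsilon> \<alpha> * a \<alpha>) u) \<le> K * poly_norm n m (lp_norm p n) a" .
  qed
qed (simp_all add: \<open>1 \<le> K\<close>)

lemma card_multi_indices_powr_le:
  assumes "1 \<le> n" "0 \<le> \<theta>" "\<theta> \<le> 1"
  shows "real (card (multi_indices n m)) powr \<theta> \<le>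
    exp (real (Suc m)) * (1 + real n / real (Suc m)) powr (real m * \<theta>)"
proof -
  let ?x = "1 + real n / real (Suc m)"
  have x: "?x > 0" by (simp add: add_pos_nonneg)
  have "real (card (multi_indices n m)) powr \<theta> \<le> (exp (real (Suc m)) * ?x ^ m) powr \<theta>"
    using card_multi_indices_le[of "Suc m" n] assms by (intro powr_mono2) auto
  also have "\<dots> = exp (real (Suc m)) powr \<theta> * ?x powr (real m * \<theta>)"
    using x by (simp only: powr_mult powr_powr flip: powr_realpow)
  also have "\<dots> \<le> exp (real (Suc m)) powr 1 * ?x powr (real m * \<theta>)"
    using assms by (intro mult_right_mono powr_mono) auto
  finally show ?thesis by simp
qed

lemma sum_coeffs_le_lp_ge_2:
  assumes "2 \<le> p" "1 \<le> n" and u: "u \<in> unit_ball n (lp_norm p n)"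
  shows "(\<Sum>\<alpha>\<in>multi_indices n (Suc m). cmod (a \<alpha>) * cmod (monomial n \<alpha> u)) \<le>
    (exp 5 ^ Suc m * (1 + real n / real (Suc m)) powr (real m * (1 / 2))) *
      poly_norm n (Suc m) (lp_norm p n) a"
proof -
  define B where "B = poly_norm n (Suc m) (lp_norm p n) a"
  let ?X = "(1 + real n / real (Suc m)) powr (real m * (1 / 2))"
  have p: "1 \<le> p" using assms(1) by (rule order_trans[rotated]) simp
  have B: "cmod (hom_poly n (Suc m) a v) \<le> B" if "v \<in> unit_ball n (lp_norm p n)" for v
    unfolding B_def using p that by (rule norm_hom_poly_le_poly_norm)
  have B0: "B \<ge> 0" using order_trans[OF norm_ge_zero B[OF u]] .
  have "(\<Sum>\<alpha>\<in>multi_indices n (Suc m). cmod (a \<alpha> * monomial n \<alpha> u)) \<le>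
      sqrt (card (multi_indices n m)) * 2 ^ m * (real (Suc m) * (exp 1 * B))"
  proof (rule sum_coeffs_le_sup_polydisc)
    fix z assume z: "z \<in> cvec n" "\<And>k. k < n \<Longrightarrow> cmod (z k) \<le> 1"
    have "lp_norm p n (\<lambda>k. u k * z k) \<le> lp_norm p n u"
      using z p assms(2) by (intro lp_norm_mono) (auto simp: norm_mult mult_left_le)
    then have "(\<lambda>k. u k * z k) \<in> unit_ball n (lp_norm p n)"
      using u by (simp add: unit_ball_def cvec_def)
    from B[OF this] show "cmod (hom_poly n (Suc m) (\<lambda>\<alpha>. a \<alpha> * monomial n \<alpha> u) z) \<le> B"
      by (simp only: hom_poly_mult)
  qed
  also have "\<dots> \<le> (exp (real (Suc m)) * ?X) * exp (real (Suc m)) * (exp (real (Suc m)) * (exp (real (Suc m)) * B))"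
  proof (intro mult_mono)
    show "sqrt (card (multi_indices n m)) \<le> exp (real (Suc m)) * ?X"
      using card_multi_indices_powr_le[of n "1 / 2" m] assms by (simp add: powr_half_sqrt)
    have "(2::real) ^ m \<le> exp 1 ^ m" using exp_ge_add_one_self[of 1] by (intro power_mono) auto
    also have "\<dots> \<le> exp (real (Suc m))" by (simp flip: exp_of_nat_mult)
    finally show "(2::real) ^ m \<le> exp (real (Suc m))" .
    show "real (Suc m) \<le> exp (real (Suc m))" using exp_ge_add_one_self[of "real (Suc m)"] by linarith
  qed (use B0 in auto)
  also have "\<dots> = exp (4 * real (Suc m)) * ?X * B"
    by (simp only: mult_ac flip: exp_add) (simp add: algebra_simps flip: exp_add)
  also have "\<dots> \<le> exp (5 * real (Suc m)) * ?X * B"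
    using B0 by (intro mult_right_mono) auto
  also have "exp (5 * real (Suc m)) = exp 5 ^ Suc m"
    by (simp only: mult.commute flip: exp_of_nat_mult)
  finally show ?thesis by (simp only: norm_mult B_def)
qed

lemma sum_coeffs_le_lq:
  assumes "1 \<le> q" "1 \<le> n" and u: "u \<in> unit_ball n (lp_norm (ereal q) n)"
  shows "(\<Sum>\<alpha>\<in>multi_indices n (Suc m). cmod (a \<alpha>) * cmod (monomial n \<alpha> u)) \<le>
    (exp 5 ^ Suc m * (1 + real n / real (Suc m)) powr (real m * (1 - 1 / q))) *
      poly_norm n (Suc m) (lp_norm (ereal q) n) a"
proof -
  define B where "B = poly_norm n (Suc m) (lp_norm (ereal q) n) a"
  let ?X = "(1 + real n / real (Suc m)) powr (real m * (1 - 1 / q))"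
  have B: "cmod (hom_poly n (Suc m) a v) \<le> B" if "v \<in> unit_ball n (lp_norm (ereal q) n)" for v
    unfolding B_def using assms(1) that by (intro norm_hom_poly_le_poly_norm) auto
  have B0: "B \<ge> 0" using order_trans[OF norm_ge_zero B[OF u]] .
  have "(\<Sum>\<alpha>\<in>multi_indices n (Suc m). cmod (a \<alpha>) * cmod (monomial n \<alpha> u)) \<le>
      real (Suc m) * (exp 2 * B) * exp (real m) * real (card (multi_indices n m)) powr (1 - 1 / q)"
    using assms(1) u
    by (intro sum_coeffs_le_sup_lq_ball B) (auto simp: unit_ball_def lp_norm_lt_1_iff)
  also have "\<dots> \<le> exp (real (Suc m)) * (exp (2 * real (Suc m)) * B) * exp (real (Suc m)) *
      (exp (real (Suc m)) * ?X)"
  proof (intro mult_mono)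
    show "real (Suc m) \<le> exp (real (Suc m))" using exp_ge_add_one_self[of "real (Suc m)"] by linarith
    show "real (card (multi_indices n m)) powr (1 - 1 / q) \<le> exp (real (Suc m)) * ?X"
      using assms by (intro card_multi_indices_powr_le) auto
  qed (use B0 in auto)
  also have "\<dots> = exp (5 * real (Suc m)) * ?X * B"
    by (simp only: mult_ac flip: exp_add) (simp add: algebra_simps flip: exp_add)
  also have "exp (5 * real (Suc m)) = exp 5 ^ Suc m"
    by (simp only: mult.commute flip: exp_of_nat_mult)
  finally show ?thesis by (simp only: B_def)
qed

theorem theorem1p2:
  "\<exists>C::real. C \<ge> 1 \<and>
     (\<forall>(p::ereal) (m::nat) (n::nat). 1 \<le> p \<longrightarrow> 1 \<le> m \<longrightarrow> 1 \<le> n \<longrightarrow>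
        chi_mon n m (lp_norm p n) \<le>
          ereal (C ^ m * (1 + real n / real m) powr
            ((real m - 1) * (1 - 1 / real_of_ereal (min p 2)))))"
proof (intro exI[of _ "exp 5"] conjI allI impI)
  fix p :: ereal and m n :: nat
  assume p: "1 \<le> p" and m: "1 \<le> m" and n: "1 \<le> n"
  define \<theta> where "\<theta> = 1 - 1 / real_of_ereal (min p 2)"
  obtain M where M: "m = Suc M" using m by (cases m) auto
  have q: "1 \<le> real_of_ereal (min p 2)"
    using p by (cases p) (auto simp: min_def)
  then have \<theta>: "0 \<le> \<theta>" by (simp add: \<theta>_def)
  show "chi_mon n m (lp_norm p n) \<le> ereal (exp 5 ^ m * (1 + real n / real m) powr ((real m - 1) * \<theta>))"
  proof (rule chi_mon_lp_le[OF p n])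
    have "1 \<le> exp (5::real) ^ m" by (simp add: one_le_power)
    moreover have "1 \<le> (1 + real n / real m) powr ((real m - 1) * \<theta>)"
      using \<theta> m by (intro ge_one_powr_ge_zero) auto
    ultimately show "1 \<le> exp 5 ^ m * (1 + real n / real m) powr ((real m - 1) * \<theta>)"
      using mult_mono[of 1 "exp (5::real) ^ m" 1] by simp
  next
    fix a u assume u: "u \<in> unit_ball n (lp_norm p n)"
    show "(\<Sum>\<alpha>\<in>multi_indices n m. cmod (a \<alpha>) * cmod (monomial n \<alpha> u)) \<le>
        exp 5 ^ m * (1 + real n / real m) powr ((real m - 1) * \<theta>) * poly_norm n m (lp_norm p n) a"
    proof (cases "2 \<le> p")
      case True
      then have \<theta>: "\<theta> = 1 / 2" by (simp add: \<theta>_def min_def)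
      show ?thesis unfolding \<theta> using sum_coeffs_le_lp_ge_2[OF True n u, of a M] by (simp add: M)
    next
      case False
      then obtain r where r: "p = ereal r" using p by (cases p) auto
      then have "\<theta> = 1 - 1 / r" using False by (simp add: \<theta>_def min_def)
      then show ?thesis using sum_coeffs_le_lq[of r n u a M] p n u by (simp add: M r)
    qed
  qed
qed simp

end
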